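(* Let $\varphi$ be an $s$-untranscendable linear order type such that $\varphi 2 \leqslant \varphi$ and $2\varphi \leqslant \varphi$. Then $\varphi^2 \leqslant \varphi$.
   Context: Work in ZFC. A linear order type is an isomorphism class of linear orders. For order types $\varphi,\psi$, write $\varphi \leqslant \psi$ if an order of type $\varphi$ embeds (by a strictly order-preserving map) into an order of type $\psi$. For linear orders $Y$ and $X$, the product $YX$ is the set $Y \times X$ ordered anti-lexicographically: $(y,x)<(y',x')$ iff $x<x'$, or $x=x'$ and $y<y'$ (i.e. every point of $X$ is replaced by a copy of $Y$); the product $\psi\varphi$ of types is the type of this order. Thus $\varphi 2 = \varphi+\varphi$ (two copies of $\varphi$ placed one after the other), $2\varphi$ is $\varphi$ with each point replaced by two points, and $\varphi^2=\varphi\varphi$. An order type $\varphi$ is $s$-untranscendable if whenever $\psi,\tau$ are order types with $\varphi \leqslant \psi\tau$, then $\varphi \leqslant \psi$ or $\varphi \leqslant \tau$. *)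

theory Defs
  imports Main
begin

text \<open>
  A linear order is a relation \<open>r\<close> with \<open>Linear_order r\<close>: it is reflexive, its carrier is
  \<open>Field r\<close>, and its strict part is \<open>r - Id\<close>. Order types are handled through representatives;
  all notions below are invariant under isomorphism. Every order type, including the empty
  one, has a representative \<open>r :: 'a rel\<close> on some type \<open>'a\<close>.
\<close>

definition ot_le :: "'a rel \<Rightarrow> 'b rel \<Rightarrow> bool" (infix "\<preceq>" 50) where
  "r \<preceq> s \<longleftrightarrow> (\<exists>f. f ` Field r \<subseteq> Field s \<and>
     monotone_on (Field r) (\<lambda>x y. (x, y) \<in> r - Id) (\<lambda>x y. (x, y) \<in> s - Id) f)"

text \<open>Anti-lexicographic: \<open>r \<otimes> s\<close> is \<open>s\<close> with every point replaced by a copy of \<open>r\<close>.\<close>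

definition ot_prod :: "'a rel \<Rightarrow> 'b rel \<Rightarrow> ('a \<times> 'b) rel" (infixr "\<otimes>" 70) where
  "r \<otimes> s = {((y, x), (y', x')). y \<in> Field r \<and> y' \<in> Field r \<and> x \<in> Field s \<and> x' \<in> Field s \<and>
     ((x, x') \<in> s - Id \<or> x = x' \<and> (y, y') \<in> r)}"

definition ot_two :: "bool rel" where
  "ot_two = {(x, y). x \<le> y}"

text \<open>
  The bound variables \<open>p\<close> and \<open>t\<close> range over linear orders carried by subsets of the type of
  \<open>r\<close>, since HOL cannot quantify over types inside a definition. This is no restriction: an
  embedding of \<open>r\<close> into \<open>p \<otimes> t\<close> only meets parts of \<open>p\<close> and \<open>t\<close> that are no larger than
  \<open>Field r\<close>. Lemma \<open>s_untranscendableD\<close> below gives the property for orders on arbitrary types.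
\<close>

definition s_untranscendable :: "'a rel \<Rightarrow> bool" where
  "s_untranscendable r \<longleftrightarrow> (\<forall>(p :: 'a rel) (t :: 'a rel). Linear_order p \<longrightarrow> Linear_order t \<longrightarrow>
     r \<preceq> p \<otimes> t \<longrightarrow> r \<preceq> p \<or> r \<preceq> t)"

lemma Field_ot_prod:
  assumes "Linear_order r" "Linear_order s"
  shows "Field (r \<otimes> s) = Field r \<times> Field s"
proof -
  have refl: "(x, x) \<in> r" if "x \<in> Field r" for x
    using assms(1) that by (auto simp: order_on_defs refl_on_def)
  show ?thesis
  proof
    have "r \<otimes> s \<subseteq> (Field r \<times> Field s) \<times> (Field r \<times> Field s)"
      unfolding ot_prod_def by auto
    then show "Field (r \<otimes> s) \<subseteq> Field r \<times> Field s"
      unfolding Field_def[of "r \<otimes> s"] by blast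
    show "Field r \<times> Field s \<subseteq> Field (r \<otimes> s)"
    proof
      fix z assume "z \<in> Field r \<times> Field s"
      then have "(z, z) \<in> r \<otimes> s"
        using refl by (auto simp: ot_prod_def)
      then show "z \<in> Field (r \<otimes> s)"
        by (rule FieldI1)
    qed
  qed
qed

lemma Linear_order_ot_prod:
  assumes "Linear_order r" "Linear_order s"
  shows "Linear_order (r \<otimes> s)"
proof -
  note F = Field_ot_prod[OF assms]
  have rr: "\<And>x. x \<in> Field r \<Longrightarrow> (x, x) \<in> r" "antisym r" "trans r" "total_on (Field r) r"
    and ss: "\<And>x. x \<in> Field s \<Longrightarrow> (x, x) \<in> s" "antisym s" "trans s" "total_on (Field s) s"
    using assms by (auto simp: order_on_defs refl_on_def)
  have "trans (r \<otimes> s)"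
  proof (rule transI)
    fix u v w assume uv: "(u, v) \<in> r \<otimes> s" and vw: "(v, w) \<in> r \<otimes> s"
    obtain a x b y c z where eq: "u = (a, x)" "v = (b, y)" "w = (c, z)"
      by (cases u; cases v; cases w)
    have "(x, z) \<in> s - Id \<or> x = z \<and> (a, c) \<in> r"
      using uv vw transD[OF rr(3), of a b c] transD[OF ss(3), of x y z] antisymD[OF ss(2), of x y]
      unfolding eq ot_prod_def by auto
    then show "(u, w) \<in> r \<otimes> s"
      using uv vw unfolding eq ot_prod_def by auto
  qed
  moreover have "antisym (r \<otimes> s)"
    using antisymD[OF ss(2)] antisymD[OF rr(2)] unfolding ot_prod_def antisym_def by auto
  moreover have "refl_on (Field (r \<otimes> s)) (r \<otimes> s)"
    unfolding F unfolding refl_on_def ot_prod_def using rr(1) by auto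
  moreover have "total_on (Field (r \<otimes> s)) (r \<otimes> s)"
    unfolding F total_on_def
  proof (intro ballI impI)
    fix u v assume "u \<in> Field r \<times> Field s" "v \<in> Field r \<times> Field s" "u \<noteq> v"
    then show "(u, v) \<in> r \<otimes> s \<or> (v, u) \<in> r \<otimes> s"
      using rr(4) ss(4) unfolding ot_prod_def total_on_def by (cases u; cases v; auto)
  qed
  moreover have "r \<otimes> s \<subseteq> Field (r \<otimes> s) \<times> Field (r \<otimes> s)"
    unfolding F unfolding ot_prod_def by auto
  ultimately show ?thesis
    unfolding order_on_defs by blast
qed

lemma ot_le_trans:
  assumes "r \<preceq> s" "s \<preceq> t"
  shows "r \<preceq> t"
proof -
  obtain f g where f: "f ` Field r \<subseteq> Field s"
      "monotone_on (Field r) (\<lambda>x y. (x, y) \<in> r - Id) (\<lambda>x y. (x, y) \<in> s - Id) f"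
    and g: "g ` Field s \<subseteq> Field t"
      "monotone_on (Field s) (\<lambda>x y. (x, y) \<in> s - Id) (\<lambda>x y. (x, y) \<in> t - Id) g"
    using assms unfolding ot_le_def by blast
  have "(g \<circ> f) ` Field r \<subseteq> Field t"
    using f(1) g(1) by auto
  moreover have "monotone_on (Field r) (\<lambda>x y. (x, y) \<in> r - Id) (\<lambda>x y. (x, y) \<in> t - Id) (g \<circ> f)"
    by (rule monotone_on_o[OF g(2) f(2) f(1)])
  ultimately show ?thesis
    unfolding ot_le_def by blast
qed

lemma pullback_order:
  fixes k :: "'a \<Rightarrow> 'b"
  assumes "Linear_order p" "inj_on k A" "k ` A \<subseteq> Field p"
  defines "q \<equiv> {(a, b). a \<in> A \<and> b \<in> A \<and> (k a, k b) \<in> p}"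
  shows "Field q = A" "Linear_order q" "q \<preceq> p"
proof -
  have pp: "\<And>x. x \<in> Field p \<Longrightarrow> (x, x) \<in> p" "antisym p" "trans p" "total_on (Field p) p"
    using assms(1) by (auto simp: order_on_defs refl_on_def)
  have k: "\<And>a. a \<in> A \<Longrightarrow> k a \<in> Field p"
    using assms(3) by auto
  show F: "Field q = A"
    using pp(1) k unfolding q_def Field_def by blast
  have "trans q"
    unfolding q_def trans_def using transD[OF pp(3)] by blast
  moreover have "antisym q"
    using antisymD[OF pp(2)] inj_onD[OF assms(2)] unfolding q_def antisym_def by auto
  moreover have "refl_on A q"
    using pp(1) k unfolding q_def refl_on_def by auto
  moreover have "total_on A q"
    unfolding q_def total_on_def
  proof (intro ballI impI)
    fix a b assume ab: "a \<in> A" "b \<in> A" "a \<noteq> b"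
    then have "k a \<noteq> k b"
      using inj_onD[OF assms(2)] by blast
    then show "(a, b) \<in> {(a, b). a \<in> A \<and> b \<in> A \<and> (k a, k b) \<in> p} \<or>
        (b, a) \<in> {(a, b). a \<in> A \<and> b \<in> A \<and> (k a, k b) \<in> p}"
      using ab k pp(4) unfolding total_on_def by blast
  qed
  moreover have "q \<subseteq> A \<times> A"
    unfolding q_def by auto
  ultimately show "Linear_order q"
    unfolding order_on_defs F by blast
  show "q \<preceq> p"
    unfolding ot_le_def F monotone_on_def using assms(3) inj_onD[OF assms(2)]
    by (intro exI[of _ k]) (auto simp: q_def)
qed

lemma s_untranscendableD:
  fixes r :: "'a rel" and p :: "'b rel" and t :: "'c rel"
  assumes "s_untranscendable r" "Linear_order p" "Linear_order t" "r \<preceq> p \<otimes> t"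
  shows "r \<preceq> p \<or> r \<preceq> t"
proof -
  obtain f where f: "f ` Field r \<subseteq> Field p \<times> Field t"
      "monotone_on (Field r) (\<lambda>x y. (x, y) \<in> r - Id) (\<lambda>x y. (x, y) \<in> p \<otimes> t - Id) f"
    using assms(4) unfolding ot_le_def Field_ot_prod[OF assms(2,3)] by blast
  define u where "u = fst \<circ> f"
  define v where "v = snd \<circ> f"
  define g where "g = inv_into (Field r) u"
  define h where "h = inv_into (Field r) v"
  define A where "A = g ` u ` Field r"
  define B where "B = h ` v ` Field r"
  have ug: "\<And>x. x \<in> Field r \<Longrightarrow> u (g (u x)) = u x"
    unfolding g_def by (rule f_inv_into_f) auto
  have vh: "\<And>x. x \<in> Field r \<Longrightarrow> v (h (v x)) = v x"
    unfolding h_def by (rule f_inv_into_f) auto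
  have uF: "u x \<in> Field p" and vF: "v x \<in> Field t" if "x \<in> Field r" for x
    using f(1) that unfolding u_def v_def by (auto simp: image_subset_iff mem_Times_iff)
  have A: "inj_on u A" "u ` A \<subseteq> Field p"
    unfolding A_def inj_on_def using ug uF by auto
  have B: "inj_on v B" "v ` B \<subseteq> Field t"
    unfolding B_def inj_on_def using vh vF by auto
  define p' where "p' = {(a, b). a \<in> A \<and> b \<in> A \<and> (u a, u b) \<in> p}"
  define t' where "t' = {(a, b). a \<in> B \<and> b \<in> B \<and> (v a, v b) \<in> t}"
  note P = pullback_order[OF assms(2) A, folded p'_def]
  note T = pullback_order[OF assms(3) B, folded t'_def]
  let ?f = "\<lambda>x. (g (u x), h (v x))"
  have "(?f x, ?f y) \<in> p' \<otimes> t' - Id"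
    if xy: "x \<in> Field r" "y \<in> Field r" "(x, y) \<in> r - Id" for x y
  proof -
    have "(f x, f y) \<in> p \<otimes> t - Id"
      using f(2) xy unfolding monotone_on_def by blast
    then have "((u x, v x), (u y, v y)) \<in> p \<otimes> t" and ne: "u x \<noteq> u y \<or> v x \<noteq> v y"
      unfolding u_def v_def by (auto simp: prod_eq_iff)
    then have d: "(v x, v y) \<in> t - Id \<or> v x = v y \<and> (u x, u y) \<in> p"
      unfolding ot_prod_def by auto
    have m: "g (u x) \<in> A" "g (u y) \<in> A" "h (v x) \<in> B" "h (v y) \<in> B"
      using xy unfolding A_def B_def by auto
    have "?f x \<noteq> ?f y"
      using ne ug[OF xy(1)] ug[OF xy(2)] vh[OF xy(1)] vh[OF xy(2)] by (metis prod.inject)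
    moreover have "(?f x, ?f y) \<in> p' \<otimes> t'"
      using d m ug[OF xy(1)] ug[OF xy(2)] vh[OF xy(1)] vh[OF xy(2)]
      unfolding ot_prod_def P(1) T(1) by (auto simp: p'_def t'_def)
    ultimately show ?thesis
      by auto
  qed
  moreover have "?f ` Field r \<subseteq> Field (p' \<otimes> t')"
    unfolding Field_ot_prod[OF P(2) T(2)] P(1) T(1) A_def B_def by auto
  ultimately have "r \<preceq> p' \<otimes> t'"
    unfolding ot_le_def monotone_on_def by (intro exI[of _ ?f]) blast
  then have "r \<preceq> p' \<or> r \<preceq> t'"
    using assms(1) P(2) T(2) unfolding s_untranscendable_def by blast
  then show ?thesis
    using ot_le_trans[OF _ P(3)] ot_le_trans[OF _ T(3)] by auto
qed

end

theory Submission
  imports Defs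
begin

text \<open>
  Let \<open>X\<close> be a nonempty order of type \<open>\<phi>\<close> and call two points equivalent if \<open>X\<close> does not embed
  into the closed interval between them. Since \<open>\<phi>2 \<preceq> \<phi>\<close>, an embedding of \<open>X\<close> into \<open>A + B\<close> yields
  one into \<open>A\<close> or into \<open>B\<close>, so this is an equivalence relation with convex classes, and no
  class embeds \<open>X\<close>. Let \<open>Z\<close> be the order of the classes, and let \<open>Y\<close> be the sum of all classes
  along some well-ordering. Then \<open>X \<preceq> Y Z\<close>. However \<open>X\<close> does not embed into \<open>Y\<close>: for a minimal
  initial segment of the well-ordering whose sum embeds \<open>X\<close>, embedding \<open>\<phi>2\<close> instead forces the
  second copy into the last class. Hence \<open>X \<preceq> Z\<close>, and therefore \<open>2X \<preceq> Z\<close>. This gives for each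
  \<open>x \<in> X\<close> a pair of inequivalent points of \<open>X\<close>, the intervals between them being disjoint and
  ordered like \<open>X\<close>. Each interval embeds \<open>X\<close>, so \<open>\<phi>\<^sup>2 \<preceq> \<phi>\<close>.
\<close>

section \<open>The order \<open>ot_two\<close>, embeddings and intervals\<close>

lemma Field_ot_two: "Field ot_two = UNIV"
  unfolding ot_two_def Field_def by auto

lemma ot_two_iff: "(a, b) \<in> ot_two \<longleftrightarrow> a \<le> b"
  unfolding ot_two_def by simp

lemma Linear_order_ot_two: "Linear_order ot_two"
  unfolding order_on_defs Field_ot_two
  by (auto simp: ot_two_def refl_on_def total_on_def intro: transI antisymI)

lemma ot_le_iff:
  "r \<preceq> s \<longleftrightarrow> (\<exists>f. (\<forall>x\<in>Field r. f x \<in> Field s) \<and>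
     (\<forall>x y. (x, y) \<in> r - Id \<longrightarrow> (f x, f y) \<in> s - Id))"
proof -
  have "x \<in> Field r \<and> y \<in> Field r" if "(x, y) \<in> r - Id" for x y
    using that by (auto simp: Field_def)
  then show ?thesis
    unfolding ot_le_def monotone_on_def image_subset_iff by blast
qed

lemma ot_leE:
  assumes "r \<preceq> s"
  obtains f where "\<And>x. x \<in> Field r \<Longrightarrow> f x \<in> Field s"
    "\<And>x y. (x, y) \<in> r - Id \<Longrightarrow> (f x, f y) \<in> s - Id"
  using assms unfolding ot_le_iff by blast

text \<open>Working with self-maps of \<open>r\<close> that land in \<open>A\<close> avoids forming
  the suborder carried by \<open>A\<close>; only the part of \<open>A\<close> inside
  \<open>Field r\<close> matters.\<close>

definition embeds_in :: "'a rel \<Rightarrow> 'a set \<Rightarrow> bool" where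
  "embeds_in r A \<longleftrightarrow> (\<exists>f. (\<forall>x\<in>Field r. f x \<in> Field r \<inter> A) \<and>
     (\<forall>x y. (x, y) \<in> r - Id \<longrightarrow> (f x, f y) \<in> r - Id))"

lemma embeds_in_mono: "embeds_in r A \<Longrightarrow> A \<inter> Field r \<subseteq> B \<Longrightarrow> embeds_in r B"
  unfolding embeds_in_def by blast

text \<open>Symmetric in the endpoints, so that no assumption on their order is needed.\<close>

definition interval :: "'a rel \<Rightarrow> 'a \<Rightarrow> 'a \<Rightarrow> 'a set" where
  "interval r x y = {z. (x, z) \<in> r \<and> (z, y) \<in> r \<or> (y, z) \<in> r \<and> (z, x) \<in> r}"

section \<open>Orders that contain two successive copies of themselves\<close>

locale doubling_order =
  fixes r :: "'a rel"
  assumes lin: "Linear_order r"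
    and doubling: "r \<otimes> ot_two \<preceq> r"
    and nonempty: "Field r \<noteq> {}"
begin

lemma order_facts:
  "\<And>x. x \<in> Field r \<Longrightarrow> (x, x) \<in> r"
  "\<And>x y. (x, y) \<in> r \<Longrightarrow> (y, x) \<in> r \<Longrightarrow> x = y"
  "\<And>x y z. (x, y) \<in> r \<Longrightarrow> (y, z) \<in> r \<Longrightarrow> (x, z) \<in> r"
  "\<And>x y. x \<in> Field r \<Longrightarrow> y \<in> Field r \<Longrightarrow> (x, y) \<in> r \<or> (y, x) \<in> r"
proof -
  have r: "refl_on (Field r) r" "antisym r" "trans r" "total_on (Field r) r"
    using lin by (auto simp: order_on_defs)
  show refl: "\<And>x. x \<in> Field r \<Longrightarrow> (x, x) \<in> r"
    using r(1) by (rule refl_onD)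
  show "\<And>x y. (x, y) \<in> r \<Longrightarrow> (y, x) \<in> r \<Longrightarrow> x = y"
    using r(2) by (rule antisymD)
  show "\<And>x y z. (x, y) \<in> r \<Longrightarrow> (y, z) \<in> r \<Longrightarrow> (x, z) \<in> r"
    using r(3) by (rule transD)
  show "\<And>x y. x \<in> Field r \<Longrightarrow> y \<in> Field r \<Longrightarrow> (x, y) \<in> r \<or> (y, x) \<in> r"
    using r(4) refl unfolding total_on_def by metis
qed

text \<open>Restrict the embedding to the copies indexed by \<open>False\<close> and
  \<open>True\<close>. As \<open>False\<close> is the smaller element of \<open>ot_two\<close>, the
  image of \<open>h\<close> lies entirely below that of \<open>k\<close>.\<close>

lemma doubling_maps:
  obtains h k where
    "\<And>x. x \<in> Field r \<Longrightarrow> h x \<in> Field r" "\<And>x. x \<in> Field r \<Longrightarrow> k x \<in> Field r"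
    "\<And>x y. (x, y) \<in> r - Id \<Longrightarrow> (h x, h y) \<in> r - Id"
    "\<And>x y. (x, y) \<in> r - Id \<Longrightarrow> (k x, k y) \<in> r - Id"
    "\<And>x y. x \<in> Field r \<Longrightarrow> y \<in> Field r \<Longrightarrow> (h x, k y) \<in> r - Id"
proof -
  obtain f where f: "\<And>x. x \<in> Field (r \<otimes> ot_two) \<Longrightarrow> f x \<in> Field r"
    "\<And>x y. (x, y) \<in> r \<otimes> ot_two - Id \<Longrightarrow> (f x, f y) \<in> r - Id"
    using ot_leE[OF doubling] by blast
  have F: "x \<in> Field r \<and> y \<in> Field r" if "(x, y) \<in> r - Id" for x y
    using that by (auto simp: Field_def)
  show thesis
  proof (rule that[of "\<lambda>x. f (x, False)" "\<lambda>x. f (x, True)"])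
    show "(f (x, False), f (y, False)) \<in> r - Id" "(f (x, True), f (y, True)) \<in> r - Id"
      if "(x, y) \<in> r - Id" for x y
      using that F[OF that] by (intro f(2); auto simp: ot_prod_def Field_ot_two)+
    show "(f (x, False), f (y, True)) \<in> r - Id" if "x \<in> Field r" "y \<in> Field r" for x y
      using that by (intro f(2)) (auto simp: ot_prod_def Field_ot_two ot_two_iff)
  qed (use f(1) in \<open>auto simp: Field_ot_prod[OF lin Linear_order_ot_two] Field_ot_two\<close>)
qed

lemma not_embeds_in_singleton: "\<not> embeds_in r {x}"
proof
  assume "embeds_in r {x}"
  then obtain f where f: "\<And>a. a \<in> Field r \<Longrightarrow> f a = x"
    "\<And>a b. (a, b) \<in> r - Id \<Longrightarrow> (f a, f b) \<in> r - Id"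
    unfolding embeds_in_def by blast
  obtain h k where hk: "\<And>x. x \<in> Field r \<Longrightarrow> h x \<in> Field r" "\<And>x. x \<in> Field r \<Longrightarrow> k x \<in> Field r"
    "\<And>x y. x \<in> Field r \<Longrightarrow> y \<in> Field r \<Longrightarrow> (h x, k y) \<in> r - Id"
    using doubling_maps by metis
  obtain a where "a \<in> Field r"
    using nonempty by blast
  then show False
    using f hk by (metis DiffE IdI)
qed

text \<open>Double the copy inside \<open>A\<close>. If its lower half does not stay below
  \<open>y\<close>, some point of that half is at or above \<open>y\<close>, and then the whole
  upper half is above \<open>y\<close>.\<close>

lemma embeds_in_cut:
  assumes "embeds_in r A" "y \<in> Field r"
  shows "embeds_in r {z \<in> A. (z, y) \<in> r} \<or> embeds_in r {z \<in> A. (y, z) \<in> r}"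
proof -
  obtain f where f: "\<And>a. a \<in> Field r \<Longrightarrow> f a \<in> Field r \<inter> A"
    "\<And>a b. (a, b) \<in> r - Id \<Longrightarrow> (f a, f b) \<in> r - Id"
    using assms(1) unfolding embeds_in_def by blast
  obtain h k where hk: "\<And>x. x \<in> Field r \<Longrightarrow> h x \<in> Field r" "\<And>x. x \<in> Field r \<Longrightarrow> k x \<in> Field r"
    "\<And>x y. (x, y) \<in> r - Id \<Longrightarrow> (h x, h y) \<in> r - Id"
    "\<And>x y. (x, y) \<in> r - Id \<Longrightarrow> (k x, k y) \<in> r - Id"
    "\<And>x y. x \<in> Field r \<Longrightarrow> y \<in> Field r \<Longrightarrow> (h x, k y) \<in> r - Id"
    using doubling_maps by metis
  show ?thesis
  proof (cases "\<forall>x\<in>Field r. (f (h x), y) \<in> r")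
    case True
    then have "embeds_in r {z \<in> A. (z, y) \<in> r}"
      unfolding embeds_in_def using f hk(1,3) by (intro exI[of _ "f \<circ> h"]) auto
    then show ?thesis ..
  next
    case False
    then obtain x where x: "x \<in> Field r" "(y, f (h x)) \<in> r"
      using order_facts(4) f(1) hk(1) assms(2) by blast
    have "(y, f (k z)) \<in> r" if "z \<in> Field r" for z
      using f(2)[OF hk(5)[OF x(1) that]] x(2) order_facts(3) by blast
    then have "embeds_in r {z \<in> A. (y, z) \<in> r}"
      unfolding embeds_in_def using f hk(2,4) by (intro exI[of _ "f \<circ> k"]) auto
    then show ?thesis ..
  qed
qed

section \<open>The equivalence of points with no copy of \<open>r\<close> between them\<close>

definition near :: "'a rel" where
  "near = {(x, y). x \<in> Field r \<and> y \<in> Field r \<and> \<not> embeds_in r (interval r x y)}"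

lemma near_refl: "x \<in> Field r \<Longrightarrow> (x, x) \<in> near"
proof -
  have "interval r x x \<subseteq> {x}"
    unfolding interval_def using order_facts(2) by blast
  then show "x \<in> Field r \<Longrightarrow> (x, x) \<in> near"
    unfolding near_def using not_embeds_in_singleton[of x] embeds_in_mono[of r _ "{x}"] by blast
qed

lemma near_sym: "(x, y) \<in> near \<Longrightarrow> (y, x) \<in> near"
proof -
  have "interval r x y = interval r y x"
    unfolding interval_def by blast
  then show "(x, y) \<in> near \<Longrightarrow> (y, x) \<in> near"
    unfolding near_def by auto
qed

text \<open>A copy of \<open>r\<close> between \<open>x\<close> and \<open>z\<close> can be cut at
  \<open>y\<close>, and each side of the cut lies in the interval from \<open>x\<close> to
  \<open>y\<close> or in that from \<open>y\<close> to \<open>z\<close>.\<close>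

lemma near_trans:
  assumes "(x, y) \<in> near" "(y, z) \<in> near"
  shows "(x, z) \<in> near"
proof -
  have F: "x \<in> Field r" "y \<in> Field r" "z \<in> Field r"
    using assms unfolding near_def by auto
  \<comment> \<open>Here \<open>y\<close> need not lie between \<open>a\<close> and
    \<open>b\<close>. The case where \<open>z\<close> is below \<open>x\<close> follows by
    exchanging the endpoints.\<close>
  have *: "{w \<in> interval r a b. (w, y) \<in> r} \<subseteq> interval r a y"
    "{w \<in> interval r a b. (y, w) \<in> r} \<subseteq> interval r y b" if "(a, b) \<in> r" for a b
    unfolding interval_def using that order_facts(3) by blast+
  have comm: "interval r a b = interval r b a" for a b
    unfolding interval_def by blast
  have "{w \<in> interval r x z. (w, y) \<in> r} \<subseteq> interval r x y \<or>
        {w \<in> interval r x z. (w, y) \<in> r} \<subseteq> interval r y z"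
    using order_facts(4)[OF F(1,3)] *(1)[of x z] *(1)[of z x] comm[of x z] comm[of y z] by metis
  moreover have "{w \<in> interval r x z. (y, w) \<in> r} \<subseteq> interval r x y \<or>
        {w \<in> interval r x z. (y, w) \<in> r} \<subseteq> interval r y z"
    using order_facts(4)[OF F(1,3)] *(2)[of x z] *(2)[of z x] comm[of x z] comm[of x y] by metis
  ultimately show ?thesis
    using assms embeds_in_cut[OF _ F(2), of "interval r x z"] embeds_in_mono[of r]
    unfolding near_def by blast
qed

lemma near_convex:
  assumes "(x, z) \<in> near" "(x, y) \<in> r" "(y, z) \<in> r"
  shows "(x, y) \<in> near"
proof -
  have "interval r x y \<subseteq> interval r x z"
    unfolding interval_def using assms(2,3) order_facts(2,3) by blast
  moreover have "y \<in> Field r"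
    using assms(2) by (auto simp: Field_def)
  ultimately show ?thesis
    using assms(1) embeds_in_mono[of r] unfolding near_def by blast
qed

section \<open>Representatives of the classes\<close>

definition rep :: "'a \<Rightarrow> 'a" where
  "rep x = (SOME y. (x, y) \<in> near)"

lemma near_rep: "x \<in> Field r \<Longrightarrow> (x, rep x) \<in> near"
  unfolding rep_def by (rule someI[of "\<lambda>y. (x, y) \<in> near" x]) (rule near_refl)

lemma rep_in_Field: "x \<in> Field r \<Longrightarrow> rep x \<in> Field r"
  using near_rep unfolding near_def by blast

text \<open>Equivalent points have the same set of points near them, so the choice operator returns
  the same value for both. Thus \<open>rep\<close> followed by \<open>Field r\<close> as image is a
  transversal of the classes.\<close>

lemma rep_eq_iff:
  assumes "x \<in> Field r" "y \<in> Field r"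
  shows "rep x = rep y \<longleftrightarrow> (x, y) \<in> near"
proof
  show "rep x = rep y \<Longrightarrow> (x, y) \<in> near"
    using near_rep[OF assms(1)] near_rep[OF assms(2)] near_sym near_trans by metis
next
  assume "(x, y) \<in> near"
  then have "(x, z) \<in> near \<longleftrightarrow> (y, z) \<in> near" for z
    using near_sym near_trans by blast
  then show "rep x = rep y"
    unfolding rep_def by simp
qed

lemma rep_idem: "x \<in> Field r \<Longrightarrow> rep (rep x) = rep x"
  using rep_eq_iff rep_in_Field near_rep near_sym by blast

text \<open>Reversed representatives of distinct classes contradict convexity: either
  \<open>y\<close> lies between \<open>x\<close> and \<open>rep x\<close>, or \<open>rep x\<close>
  lies between \<open>rep y\<close> and \<open>y\<close>.\<close>

lemma rep_mono:
  assumes "(x, y) \<in> r"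
  shows "(rep x, rep y) \<in> r"
proof (rule ccontr)
  have F: "x \<in> Field r" "y \<in> Field r"
    using assms by (auto simp: Field_def)
  assume n: "(rep x, rep y) \<notin> r"
  then have yx: "(rep y, rep x) \<in> r"
    using F rep_in_Field order_facts(4) by blast
  have "rep x \<noteq> rep y"
    using n F rep_in_Field order_facts(1) by metis
  then have ne: "(x, y) \<notin> near"
    using rep_eq_iff F by blast
  have nx: "(x, rep x) \<in> near" and ny: "(y, rep y) \<in> near"
    using near_rep F by auto
  show False
  proof (cases "(y, rep x) \<in> r")
    case True
    then show False
      using near_convex[OF nx assms] ne by blast
  next
    case False
    then have "(rep x, y) \<in> r"
      using F rep_in_Field order_facts(4) by blast
    then have "(rep y, rep x) \<in> near"
      using near_convex[OF near_sym[OF ny] yx] by blast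
    then show False
      using nx ny ne near_sym near_trans by blast
  qed
qed

section \<open>Single classes and their well-ordered sums\<close>

lemma class_not_embeds: "\<not> embeds_in r {x. rep x = a}"
proof
  assume "embeds_in r {x. rep x = a}"
  then obtain f where f: "\<And>x. x \<in> Field r \<Longrightarrow> f x \<in> Field r" "\<And>x. x \<in> Field r \<Longrightarrow> rep (f x) = a"
    "\<And>x y. (x, y) \<in> r - Id \<Longrightarrow> (f x, f y) \<in> r - Id"
    unfolding embeds_in_def by blast
  obtain h k where hk: "\<And>x. x \<in> Field r \<Longrightarrow> h x \<in> Field r" "\<And>x. x \<in> Field r \<Longrightarrow> k x \<in> Field r"
    "\<And>x y. (x, y) \<in> r - Id \<Longrightarrow> (h x, h y) \<in> r - Id"
    "\<And>x y. (x, y) \<in> r - Id \<Longrightarrow> (k x, k y) \<in> r - Id"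
    "\<And>x y. x \<in> Field r \<Longrightarrow> y \<in> Field r \<Longrightarrow> (h x, k y) \<in> r - Id"
    using doubling_maps by metis
  obtain x0 where x0: "x0 \<in> Field r"
    using nonempty by blast
  \<comment> \<open>Doubling twice gives three successive copies: \<open>h x0\<close> is below every
    \<open>k (h x)\<close>, and these are below \<open>k (k x0)\<close>. So \<open>f\<close> maps
    the middle copy between two points of one class.\<close>
  let ?u = "f (h x0)" and ?v = "f (k (k x0))"
  have 1: "(?u, f (k (h x))) \<in> r" if "x \<in> Field r" for x
    using f(3)[OF hk(5)[OF x0 hk(1)[OF that]]] by blast
  have 2: "(f (k (h x)), ?v) \<in> r" if "x \<in> Field r" for x
    using f(3)[OF hk(4)[OF hk(5)[OF that x0]]] by blast
  have "f (k (h x)) \<in> Field r \<inter> interval r ?u ?v" if "x \<in> Field r" for x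
    unfolding interval_def using 1 2 f(1) hk(1,2) that by simp
  moreover have "(f (k (h x)), f (k (h y))) \<in> r - Id" if "(x, y) \<in> r - Id" for x y
    using f(3) hk(3,4) that by blast
  ultimately have "embeds_in r (interval r ?u ?v)"
    unfolding embeds_in_def by (intro exI[of _ "\<lambda>x. f (k (h x))"]) blast
  moreover have "(?u, ?v) \<in> near"
    using rep_eq_iff f(1,2) hk(1,2) x0 by metis
  ultimately show False
    unfolding near_def by blast
qed

text \<open>The conditions on \<open>f\<close> encode an embedding into the sum of the classes along
  \<open>w\<close>, without forming that order.\<close>

lemma wellordered_sum_of_classes_not_embeds:
  assumes w: "Well_order w" "Field w = UNIV"
    and f: "\<And>x. x \<in> Field r \<Longrightarrow> f x \<in> Field r"
      "\<And>x y. (x, y) \<in> r - Id \<Longrightarrow> (rep (f x), rep (f y)) \<in> w"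
      "\<And>x y. (x, y) \<in> r - Id \<Longrightarrow> rep (f x) = rep (f y) \<Longrightarrow> (f x, f y) \<in> r - Id"
  shows False
proof -
  obtain h k where hk: "\<And>x. x \<in> Field r \<Longrightarrow> h x \<in> Field r" "\<And>x. x \<in> Field r \<Longrightarrow> k x \<in> Field r"
    "\<And>x y. (x, y) \<in> r - Id \<Longrightarrow> (h x, h y) \<in> r - Id"
    "\<And>x y. (x, y) \<in> r - Id \<Longrightarrow> (k x, k y) \<in> r - Id"
    "\<And>x y. x \<in> Field r \<Longrightarrow> y \<in> Field r \<Longrightarrow> (h x, k y) \<in> r - Id"
    using doubling_maps by metis
  \<comment> \<open>\<open>P g a\<close> says that \<open>g\<close> embeds \<open>r\<close> into the
    sum of the classes with representative at most \<open>a\<close> in \<open>w\<close>.\<close>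
  define P where "P g a \<longleftrightarrow> (\<forall>x\<in>Field r. g x \<in> Field r \<and> (rep (g x), a) \<in> w) \<and>
    (\<forall>x y. (x, y) \<in> r - Id \<longrightarrow> (rep (g x), rep (g y)) \<in> w \<and>
      (rep (g x) = rep (g y) \<longrightarrow> (g x, g y) \<in> r - Id))" for g a
  have antisym: "antisym w" and wf: "wf (w - Id)"
    using w(1) unfolding order_on_defs well_order_on_def by auto
  obtain x0 where x0: "x0 \<in> Field r"
    using nonempty by blast
  \<comment> \<open>A point of the upper half bounds the lower half, so some \<open>a\<close>
    qualifies.\<close>
  have "P (f \<circ> h) (rep (f (k x0)))"
    unfolding P_def using f hk(1,3,5) x0 by auto
  then have "rep (f (k x0)) \<in> {a. \<exists>g. P g a}"
    by blast
  then obtain a where "a \<in> {a. \<exists>g. P g a}"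
    and min: "\<And>b. (b, a) \<in> w - Id \<Longrightarrow> b \<notin> {a. \<exists>g. P g a}"
    by (rule wfE_min[OF wf]) blast
  then obtain g where g: "P g a"
    by blast
  have top: "rep (g (k x)) = a" if x: "x \<in> Field r" for x
  proof -
    \<comment> \<open>The class of any point of the upper half bounds the lower half, so minimality
      forces that class to be \<open>a\<close>.\<close>
    have "P (g \<circ> h) (rep (g (k x)))"
      using g hk(1,3,5) x unfolding P_def by auto
    then have "(rep (g (k x)), a) \<notin> w - Id"
      using min by blast
    moreover have "(rep (g (k x)), a) \<in> w"
      using g hk(2) x unfolding P_def by blast
    ultimately show ?thesis
      by blast
  qed
  have "(g (k x), g (k y)) \<in> r - Id" if "(x, y) \<in> r - Id" for x y
  proof -
    have "x \<in> Field r" "y \<in> Field r"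
      using that by (auto simp: Field_def)
    then show ?thesis
      using g hk(4)[OF that] top unfolding P_def by simp
  qed
  then have "embeds_in r {x. rep x = a}"
    unfolding embeds_in_def using g hk(2) top unfolding P_def
    by (intro exI[of _ "g \<circ> k"]) auto
  then show False
    using class_not_embeds by blast
qed

section \<open>Embedding \<open>r\<close> into the order of the classes\<close>

lemma embeds_in_classes:
  assumes "s_untranscendable r"
  obtains e where "\<And>x. x \<in> Field r \<Longrightarrow> e x \<in> rep ` Field r"
    "\<And>x y. (x, y) \<in> r - Id \<Longrightarrow> (e x, e y) \<in> r - Id"
proof -
  obtain w :: "'a rel" where w: "Well_order w" "Field w = UNIV"
    using well_ordering[where 'a = 'a] by (elim exE conjE)
  have wlin: "Linear_order w"
    using w(1) unfolding well_order_on_def by blast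
  note prod = Linear_order_ot_prod[OF lin wlin] Field_ot_prod[OF lin wlin]
  \<comment> \<open>Points are compared first by class along \<open>w\<close>, then by
    \<open>r\<close> within a class; this is the pullback of \<open>r \<otimes> w\<close> along the
    map sending \<open>x\<close> to \<open>(x, rep x)\<close>.\<close>
  define p where "p = {(a, b). a \<in> Field r \<and> b \<in> Field r \<and> ((a, rep a), (b, rep b)) \<in> r \<otimes> w}"
  \<comment> \<open>The order of the classes, carried by representatives; \<open>id\<close> gives it
    the shape required by \<open>pullback_order\<close>.\<close>
  define t where "t = {(a, b). a \<in> rep ` Field r \<and> b \<in> rep ` Field r \<and> (id a, id b) \<in> r}"
  have "(\<lambda>x. (x, rep x)) ` Field r \<subseteq> Field (r \<otimes> w)" "inj_on (\<lambda>x. (x, rep x)) (Field r)"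
    unfolding prod(2) w(2) by (auto simp: inj_on_def)
  then have p: "Field p = Field r" "Linear_order p"
    unfolding p_def using pullback_order(1,2)[OF prod(1)] by blast+
  have t: "Field t = rep ` Field r" "Linear_order t"
    using pullback_order(1,2)[OF lin, of id "rep ` Field r"] rep_in_Field unfolding t_def
    by (auto simp: image_subset_iff)
  have F: "x \<in> Field r \<and> y \<in> Field r" if "(x, y) \<in> r - Id" for x y
    using that by (auto simp: Field_def)
  have w_refl: "(a, a) \<in> w" for a
    using wlin w(2) unfolding order_on_defs refl_on_def by auto
  \<comment> \<open>Distinct classes are compared in the second coordinate, by
    \<open>rep_mono\<close>; within one class \<open>p\<close> agrees with \<open>r\<close>.\<close>
  have "((x, rep x), (y, rep y)) \<in> p \<otimes> t - Id" if xy: "(x, y) \<in> r - Id" for x y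
  proof -
    have "(rep x, rep y) \<in> t"
      using xy F[OF xy] rep_mono unfolding t_def by auto
    moreover have "(x, y) \<in> p" if "rep x = rep y"
      using that xy F[OF xy] unfolding p_def ot_prod_def w(2) by auto
    ultimately show ?thesis
      using xy F[OF xy] unfolding ot_prod_def p(1) t(1) by auto
  qed
  then have "r \<preceq> p \<otimes> t"
    unfolding ot_le_iff Field_ot_prod[OF p(2) t(2)] p(1) t(1)
    by (intro exI[of _ "\<lambda>x. (x, rep x)"]) blast
  moreover have "\<not> r \<preceq> p"
  proof
    assume "r \<preceq> p"
    then obtain f where f: "\<And>x. x \<in> Field r \<Longrightarrow> f x \<in> Field r"
      "\<And>x y. (x, y) \<in> r - Id \<Longrightarrow> (f x, f y) \<in> p - Id"
      using ot_leE[OF \<open>r \<preceq> p\<close>, unfolded p(1)] by blast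
    have cases: "(rep (f x), rep (f y)) \<in> w - Id \<or> rep (f x) = rep (f y) \<and> (f x, f y) \<in> r - Id"
      if "(x, y) \<in> r - Id" for x y
      using f(2)[OF that] unfolding p_def ot_prod_def by auto
    show False
    proof (rule wellordered_sum_of_classes_not_embeds[OF w f(1)])
      show "(rep (f x), rep (f y)) \<in> w" if "(x, y) \<in> r - Id" for x y
        using cases[OF that] w_refl by auto
      show "(f x, f y) \<in> r - Id" if "(x, y) \<in> r - Id" "rep (f x) = rep (f y)" for x y
        using cases[OF that(1)] that(2) by auto
    qed
  qed
  ultimately have "r \<preceq> t"
    using s_untranscendableD[OF assms p(2) t(2)] by blast
  then obtain e where e: "\<And>x. x \<in> Field r \<Longrightarrow> e x \<in> rep ` Field r"
    "\<And>x y. (x, y) \<in> r - Id \<Longrightarrow> (e x, e y) \<in> t - Id"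
    using ot_leE[OF \<open>r \<preceq> t\<close>, unfolded t(1)] by blast
  show thesis
    by (rule that[of e]) (use e F in \<open>auto simp: t_def\<close>)
qed

section \<open>Copies of \<open>r\<close> in disjoint intervals\<close>

lemma square_le:
  assumes "s_untranscendable r" "ot_two \<otimes> r \<preceq> r"
  shows "r \<otimes> r \<preceq> r"
proof -
  obtain e where e: "\<And>x. x \<in> Field r \<Longrightarrow> e x \<in> rep ` Field r"
    "\<And>x y. (x, y) \<in> r - Id \<Longrightarrow> (e x, e y) \<in> r - Id"
    using embeds_in_classes[OF assms(1)] by metis
  obtain g where g: "\<And>x. x \<in> Field (ot_two \<otimes> r) \<Longrightarrow> g x \<in> Field r"
    "\<And>x y. (x, y) \<in> ot_two \<otimes> r - Id \<Longrightarrow> (g x, g y) \<in> r - Id"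
    using ot_leE[OF assms(2)] by blast
  \<comment> \<open>\<open>u x\<close> and \<open>v x\<close> are the two points replacing
    \<open>x\<close> in \<open>ot_two \<otimes> r\<close>, carried into the set of
    representatives.\<close>
  define u where "u x = e (g (False, x))" for x
  define v where "v x = e (g (True, x))" for x
  have rep_uv: "u x \<in> rep ` Field r" "v x \<in> rep ` Field r" if "x \<in> Field r" for x
    unfolding u_def v_def using e(1) g(1) that
    by (auto simp: Field_ot_prod[OF Linear_order_ot_two lin] Field_ot_two)
  have uv: "(u x, v x) \<in> r - Id" if "x \<in> Field r" for x
    unfolding u_def v_def using that
    by (intro e(2) g(2)) (auto simp: ot_prod_def Field_ot_two ot_two_iff)
  have vu: "(v x, u y) \<in> r - Id" if "x \<in> Field r" "y \<in> Field r" "(x, y) \<in> r - Id" for x y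
    unfolding u_def v_def using that
    by (intro e(2) g(2)) (auto simp: ot_prod_def Field_ot_two)
  have "embeds_in r (interval r (u x) (v x))" if x: "x \<in> Field r" for x
  proof -
    have "rep (u x) = u x" "rep (v x) = v x" "u x \<in> Field r" "v x \<in> Field r"
      using rep_uv[OF x] rep_idem rep_in_Field by auto
    \<comment> \<open>Distinct representatives are never equivalent, so a copy of \<open>r\<close>
      lies between them.\<close>
    then have "(u x, v x) \<notin> near"
      using rep_eq_iff uv[OF x] by force
    then show ?thesis
      using \<open>u x \<in> Field r\<close> \<open>v x \<in> Field r\<close> unfolding near_def by blast
  qed
  then obtain k where k: "\<And>x a. x \<in> Field r \<Longrightarrow> a \<in> Field r \<Longrightarrow>
      k x a \<in> Field r \<inter> interval r (u x) (v x)"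
    "\<And>x a b. x \<in> Field r \<Longrightarrow> (a, b) \<in> r - Id \<Longrightarrow> (k x a, k x b) \<in> r - Id"
    unfolding embeds_in_def by metis
  have between: "(u x, k x a) \<in> r \<and> (k x a, v x) \<in> r" if "x \<in> Field r" "a \<in> Field r" for x a
    using k(1)[OF that] uv[OF that(1)] order_facts(2,3) unfolding interval_def by blast
  have "(k x a, k y b) \<in> r - Id" if less: "((a, x), (b, y)) \<in> r \<otimes> r - Id" for a x b y
  proof -
    have F: "a \<in> Field r" "x \<in> Field r" "b \<in> Field r" "y \<in> Field r"
      using less unfolding ot_prod_def by auto
    show ?thesis
    proof (cases "x = y")
      case True
      then show ?thesis
        using less k(2) unfolding ot_prod_def by auto
    next
      case False
      then have "(x, y) \<in> r - Id"
        using less unfolding ot_prod_def by auto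
      \<comment> \<open>The interval over \<open>x\<close> ends strictly before the one over
        \<open>y\<close> begins.\<close>
      then have vu': "(v x, u y) \<in> r" "v x \<noteq> u y"
        using vu[of x y] F by auto
      have a: "(k x a, v x) \<in> r" and b: "(u y, k y b) \<in> r"
        using between F by auto
      have "k x a \<noteq> k y b"
        using order_facts(2)[OF vu'(1) order_facts(3)[OF b]] a vu'(2) by auto
      then show ?thesis
        using order_facts(3)[OF a order_facts(3)[OF vu'(1) b]] by simp
    qed
  qed
  then show ?thesis
    unfolding ot_le_iff Field_ot_prod[OF lin lin] using k(1)
    by (intro exI[of _ "\<lambda>(a, x). k x a"]) (simp add: split_paired_all)
qed

end

theorem theorem4p16:
  fixes r :: "'a rel"
  assumes "Linear_order r"
    and "s_untranscendable r"
    and "r \<otimes> ot_two \<preceq> r"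
    and "ot_two \<otimes> r \<preceq> r"
  shows "r \<otimes> r \<preceq> r"
proof (cases "Field r = {}")
  \<comment> \<open>The empty order embeds into every set, so \<open>near\<close> would be empty;
    this case is settled directly.\<close>
  case True
  then show ?thesis
    unfolding ot_le_iff Field_ot_prod[OF assms(1,1)] by (simp add: ot_prod_def)
next
  case False
  then interpret doubling_order r
    using assms by unfold_locales
  show ?thesis
    using square_le assms(2,4) .
qed

end
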